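(* Let $F$ be a monotone 3-CNF formula in which every variable occurs exactly once negated and exactly three times unnegated. Then there exists a satisfying color-structure for $F$; that is, there is a set $S$ of variables of $F$ such that (i) $S$ contains exactly one variable from each negative clause of $F$, and (ii) no positive clause of $F$ has all of its variables in $S$. (Consequently, every such formula $F$ is satisfiable.)
   Context: A 3-CNF formula is a conjunction of clauses, each a disjunction of exactly three literals. It is monotone if every clause is either positive (all literals unnegated) or negative (all literals negated). Since every variable occurs exactly once negated, the negative clauses partition the variables; the negative clause containing a variable is called its color. A color-structure for $F$ is determined by a set $S$ of variables (the "intersections", set to false; all other variables are set to true) such that every positive clause containing a variable of $S$ also contains a variable not in $S$. A satisfying color-structure is a color-structure in which $S$ contains exactly one variable of each color. *)

theory Defs
  imports "HOL-Library.Multiset"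
begin

datatype 'a literal = Pos 'a | Neg 'a

primrec lit_var :: "'a literal \<Rightarrow> 'a" where
  "lit_var (Pos x) = x"
| "lit_var (Neg x) = x"

text \<open>
  A clause is a set of literals, so its literals are pairwise distinct. A formula is a finite
  multiset of clauses: the same clause may occur several times in the conjunction, and each
  copy counts towards the number of occurrences of its literals.
\<close>

type_synonym 'a clause = "'a literal set"
type_synonym 'a cnf = "'a clause multiset"

definition clause_vars :: "'a clause \<Rightarrow> 'a set" where
  "clause_vars C = lit_var ` C"

definition cnf_vars :: "'a cnf \<Rightarrow> 'a set" where
  "cnf_vars F = (\<Union>C\<in>set_mset F. clause_vars C)"

definition positive_clause :: "'a clause \<Rightarrow> bool" where
  "positive_clause C \<longleftrightarrow> (\<forall>l\<in>C. \<exists>x. l = Pos x)"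

definition negative_clause :: "'a clause \<Rightarrow> bool" where
  "negative_clause C \<longleftrightarrow> (\<forall>l\<in>C. \<exists>x. l = Neg x)"

definition three_cnf :: "'a cnf \<Rightarrow> bool" where
  "three_cnf F \<longleftrightarrow> (\<forall>C\<in>#F. card C = 3)"

definition monotone_cnf :: "'a cnf \<Rightarrow> bool" where
  "monotone_cnf F \<longleftrightarrow> (\<forall>C\<in>#F. positive_clause C \<or> negative_clause C)"

definition occurrences :: "'a literal \<Rightarrow> 'a cnf \<Rightarrow> nat" where
  "occurrences l F = size {#C \<in># F. l \<in> C#}"

primrec lit_true :: "('a \<Rightarrow> bool) \<Rightarrow> 'a literal \<Rightarrow> bool" where
  "lit_true \<beta> (Pos x) \<longleftrightarrow> \<beta> x"
| "lit_true \<beta> (Neg x) \<longleftrightarrow> \<not> \<beta> x"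

definition satisfies :: "('a \<Rightarrow> bool) \<Rightarrow> 'a cnf \<Rightarrow> bool" where
  "satisfies \<beta> F \<longleftrightarrow> (\<forall>C\<in>#F. \<exists>l\<in>C. lit_true \<beta> l)"

definition satisfiable :: "'a cnf \<Rightarrow> bool" where
  "satisfiable F \<longleftrightarrow> (\<exists>\<beta>. satisfies \<beta> F)"

text \<open>
  The color of a variable is the negative clause containing it, so the colors of a formula are
  its negative clauses.
\<close>

definition colors :: "'a cnf \<Rightarrow> 'a clause set" where
  "colors F = {C \<in> set_mset F. negative_clause C}"

text \<open>
  A color-structure is represented by its set \<open>S\<close> of intersections; the associated assignment is
  \<open>\<lambda>x. x \<notin> S\<close>.
\<close>

definition color_structure :: "'a cnf \<Rightarrow> 'a set \<Rightarrow> bool" where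
  "color_structure F S \<longleftrightarrow> S \<subseteq> cnf_vars F \<and>
     (\<forall>C\<in>#F. positive_clause C \<longrightarrow> (\<exists>x\<in>clause_vars C. x \<in> S) \<longrightarrow> (\<exists>y\<in>clause_vars C. y \<notin> S))"

definition satisfying_color_structure :: "'a cnf \<Rightarrow> 'a set \<Rightarrow> bool" where
  "satisfying_color_structure F S \<longleftrightarrow>
     color_structure F S \<and> (\<forall>K\<in>colors F. \<exists>!x. x \<in> S \<and> x \<in> clause_vars K)"

end

theory Submission
  imports Defs "HOL-Library.Z2" "HOL-Library.Disjoint_Sets"
begin

text \<open>
  The set \<open>S\<close> is an independent transversal: the negative clauses are classes of size three, and \<open>S\<close> has
  to avoid the positive clauses, a hypergraph of rank three and maximum degree three. By the topological
  version of Hall's theorem it suffices that, for every family of \<open>k\<close> classes, the complex of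
  independent sets in their union has vanishing reduced homology modulo two below dimension \<open>k - 1\<close>.

  This connectivity is proved by deleting or contracting one edge at a time (Meshulam's game). Weigh an
  edge \<open>e\<close> by \<open>3 - card e\<close> and subtract the total weight from twice the number of vertices. Contracting
  a triple gains two dimensions and lowers this quantity by at most twelve. So contracting all triples
  first reduces the claim to graphs of maximum degree three. There an edge at a leaf is contracted while
  there is one; if all degrees are at least two, then there are at least as many edges as vertices, and it
  suffices that each contraction gains one dimension and removes at most six vertices. The initial value
  is six per class.
\<close>

subsection \<open>Homology modulo two\<close>

text \<open>
  A chain over the field with two elements is a function on finite sets of vertices; \<open>U\<close> is a finite
  ambient vertex set, needed only to make the boundary sum finite. Chains are graded by cardinality
  (dimension plus one) and the empty simplex is included, so the homology is reduced.
\<close>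

definition boundary :: "'a set \<Rightarrow> ('a set \<Rightarrow> bit) \<Rightarrow> 'a set \<Rightarrow> bit" where
  "boundary U c s = (\<Sum>x\<in>U - s. c (insert x s))"

definition chain :: "'a set set \<Rightarrow> nat \<Rightarrow> ('a set \<Rightarrow> bit) \<Rightarrow> bool" where
  "chain K d c \<longleftrightarrow> (\<forall>s. c s = 1 \<longrightarrow> s \<in> K \<and> card s = d)"

definition acyclic_below :: "'a set \<Rightarrow> 'a set set \<Rightarrow> nat \<Rightarrow> bool" where
  "acyclic_below U K k \<longleftrightarrow>
     (\<forall>d<k. \<forall>z. chain K d z \<and> (\<forall>s. boundary U z s = 0) \<longrightarrow>
        (\<exists>y. chain K (Suc d) y \<and> boundary U y = z))"

(* This simp rule of Z2 would rewrite sums of bits out of reach of the lemmas on sums. *)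
declare add_bit_eq_xor [simp del]

lemma bit_add_self [simp]: "(a::bit) + a = 0"
  by (cases a) simp_all

section \<open>Arithmetic modulo two, boundaries and cones\<close>

lemma bit_add_eq_0_iff: "(a::bit) + b = 0 \<longleftrightarrow> a = b"
  by (cases a; cases b) simp_all

lemma bit_sum_eq_1E:
  fixes f :: "'a \<Rightarrow> bit"
  assumes "sum f A = 1"
  obtains x where "x \<in> A" "f x = 1"
proof (cases "\<exists>x\<in>A. f x = 1")
  case False
  then have "sum f A = 0" by (intro sum.neutral) auto
  then show ?thesis using assms by simp
qed (use that in blast)

text \<open>The pairs \<open>(x, y)\<close> and \<open>(y, x)\<close> cancel modulo two. This one
  cancellation yields that boundaries are cycles, the Sperner-type count, and the cycle condition
  for compatible fillings.\<close>

lemma bit_sum_symmetric: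
  fixes g :: "'a \<Rightarrow> 'a \<Rightarrow> bit"
  assumes "finite A" and "\<And>x y. g x y = g y x"
  shows "(\<Sum>x\<in>A. \<Sum>y\<in>A - {x}. g x y) = 0"
  using assms(1)
proof induction
  case (insert a A)
  have "(\<Sum>y\<in>insert a A - {x}. g x y) = g x a + (\<Sum>y\<in>A - {x}. g x y)" if "x \<in> A" for x
  proof -
    have "insert a A - {x} = insert a (A - {x})"
      using insert that by auto
    then show ?thesis using insert by simp
  qed
  moreover have "insert a A - {a} = A" using insert by auto
  ultimately show ?case
    using insert assms(2) [of a] by (simp add: sum.distrib add.assoc [symmetric])
qed simp

lemma boundary_add:
  "boundary U (\<lambda>s. c s + d s) s = boundary U c s + boundary U d s"
  by (simp add: boundary_def sum.distrib)

lemma boundary_boundary: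
  assumes "finite U"
  shows "boundary U (boundary U c) s = 0"
proof -
  have "U - insert x s = U - s - {x}" for x by auto
  then have "boundary U (boundary U c) s
      = (\<Sum>x\<in>U - s. \<Sum>y\<in>U - s - {x}. c (insert y (insert x s)))"
    by (simp add: boundary_def)
  also have "\<dots> = 0"
    using assms by (intro bit_sum_symmetric) (auto simp: insert_commute)
  finally show ?thesis .
qed

lemma acyclic_below_0 [simp]: "acyclic_below U K 0"
  by (simp add: acyclic_below_def)

text \<open>The void complex lacks even the empty simplex, so zero is its only chain and fills
  itself.\<close>

lemma acyclic_below_void: "acyclic_below U {} k"
proof -
  have "\<exists>y. chain {} (Suc d) y \<and> boundary U y = z" if "chain {} d z" for d z
    using that by (intro exI [of _ z]) (auto simp: chain_def boundary_def)
  then show ?thesis by (auto simp: acyclic_below_def)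
qed

lemma acyclic_below_cone:
  assumes "finite U" and "v \<in> U" and "\<And>s. s \<in> K \<Longrightarrow> insert v s \<in> K \<and> finite s"
  shows "acyclic_below U K k"
  unfolding acyclic_below_def
proof (intro allI impI, elim conjE)
  fix d z
  assume z: "chain K d z" and bz: "\<forall>s. boundary U z s = 0"
  define y where "y s = (if v \<in> s then z (s - {v}) else 0)" for s
  have "chain K (Suc d) y"
    unfolding chain_def
  proof (intro allI impI)
    fix s assume "y s = 1"
    then have v: "v \<in> s" and "z (s - {v}) = 1" by (auto simp: y_def split: if_splits)
    then have "s - {v} \<in> K" "card (s - {v}) = d" using z by (auto simp: chain_def)
    moreover from this have "insert v (s - {v}) \<in> K" "finite (s - {v})"
      using assms(3) by blast+
    moreover have "insert v (s - {v}) = s" using v by auto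
    ultimately show "s \<in> K \<and> card s = Suc d"
      using v card_insert_disjoint [of "s - {v}" v] by simp
  qed
  moreover have "boundary U y = z"
  proof
    fix s
    show "boundary U y s = z s"
    proof (cases "v \<in> s")
      case False
      have "boundary U y s = y (insert v s) + (\<Sum>x\<in>U - s - {v}. y (insert x s))"
        unfolding boundary_def using assms False by (subst sum.remove [of _ v]) auto
      also have "(\<Sum>x\<in>U - s - {v}. y (insert x s)) = 0"
        using False by (intro sum.neutral) (auto simp: y_def)
      moreover have "y (insert v s) = z s" using False by (simp add: y_def)
      ultimately show ?thesis by simp
    next
      case True
      have "boundary U y s = (\<Sum>x\<in>U - s. z (insert x (s - {v})))"
        unfolding boundary_def using True
        by (intro sum.cong) (auto simp: y_def insert_Diff_if)
      \<comment> \<open>The boundary of \<open>z\<close> at \<open>s - {v}\<close> has just one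
        further term, that of the vertex \<open>v\<close>, and this term is \<open>z s\<close>.
        Since \<open>z\<close> is a cycle, the remaining sum equals \<open>z s\<close>.\<close>
      also have "z s + \<dots> = boundary U z (s - {v})"
      proof -
        have "U - (s - {v}) = insert v (U - s)" using assms True by auto
        then show ?thesis
          using assms True by (simp add: boundary_def insert_absorb)
      qed
      finally show ?thesis using bz by (auto simp: bit_add_eq_0_iff)
    qed
  qed
  ultimately show "\<exists>y. chain K (Suc d) y \<and> boundary U y = z" by blast
qed

text \<open>
  Filling a cycle in \<open>K\<close> may use simplices containing \<open>e\<close>. Their \<open>e\<close>-free parts form a cycle in the link
  of \<open>e\<close>; a filling of it, joined with \<open>e\<close>, has a boundary that cancels those simplices.
\<close>

lemma acyclic_below_remove_star:
  assumes U: "finite U" and e: "e \<subseteq> U"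
    and down: "\<And>s t. s \<in> K \<Longrightarrow> t \<subseteq> s \<Longrightarrow> t \<in> K" and KU: "K \<subseteq> Pow U"
    and K: "acyclic_below U K k"
    and L: "acyclic_below U {s. s \<inter> e = {} \<and> s \<union> e \<in> K} (k + 1 - card e)"
  shows "acyclic_below U {s \<in> K. \<not> e \<subseteq> s} k"
  unfolding acyclic_below_def
proof (intro allI impI, elim conjE)
  let ?K = "{s \<in> K. \<not> e \<subseteq> s}" and ?L = "{s. s \<inter> e = {} \<and> s \<union> e \<in> K}"
  fix d z
  assume d: "d < k" and z: "chain ?K d z" and bz: "\<forall>s. boundary U z s = 0"
  have "chain K d z" using z by (auto simp: chain_def)
  then obtain y where y: "chain K (Suc d) y" "boundary U y = z"
    using K d bz unfolding acyclic_below_def by blast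
  have fin: "finite s" if "s \<in> K" for s
    using that KU U by (meson PowD finite_subset subsetD)
  have fe: "finite e" using U e finite_subset by blast
  show "\<exists>y. chain ?K (Suc d) y \<and> boundary U y = z"
  proof (cases "card e \<le> Suc d")
    \<comment> \<open>The simplices of the filling \<open>y\<close> are too small to contain
      \<open>e\<close>, so \<open>y\<close> already works.\<close>
    case False
    have "\<not> e \<subseteq> s" if "y s = 1" for s
      using that y(1) False fin card_mono [of s e] unfolding chain_def by metis
    then have "chain ?K (Suc d) y" using y(1) by (auto simp: chain_def)
    then show ?thesis using y(2) by blast
  next
    case True
    define n where "n = Suc d - card e"
    \<comment> \<open>A simplex of \<open>y\<close> has \<open>d + 1\<close> vertices, so its
      \<open>e\<close>-free part has \<open>n\<close>. The bound on \<open>n\<close> is where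
      \<open>k + 1 - card e\<close> comes from.\<close>
    have n: "Suc d = n + card e" "n < k + 1 - card e" using True d by (auto simp: n_def)
    define w where "w s = (if s \<inter> e = {} then y (s \<union> e) else 0)" for s
    have "chain ?L n w"
      unfolding chain_def
    proof (intro allI impI)
      fix s assume "w s = 1"
      then have s: "s \<inter> e = {}" "y (s \<union> e) = 1" by (auto simp: w_def split: if_splits)
      then have "s \<union> e \<in> K" "card (s \<union> e) = Suc d" using y(1) by (auto simp: chain_def)
      then show "s \<in> ?L \<and> card s = n"
        using s fin [of "s \<union> e"] n by (auto simp: card_Un_disjoint)
    qed
    moreover have "boundary U w s = 0" for s
    proof (cases "s \<inter> e = {}")
      case True
      have "boundary U w s = (\<Sum>x\<in>U - (s \<union> e). w (insert x s))"
        unfolding boundary_def using U by (intro sum.mono_neutral_right) (auto simp: w_def)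
      also have "\<dots> = boundary U y (s \<union> e)"
        unfolding boundary_def using True by (intro sum.cong) (auto simp: w_def)
      \<comment> \<open>The boundary of \<open>y\<close> is \<open>z\<close>, which vanishes on
        every set containing \<open>e\<close>.\<close>
      also have "\<dots> = 0" using z by (auto simp: y(2) chain_def)
      finally show ?thesis .
    next
      case False
      then have "w (insert x s) = 0" for x by (auto simp: w_def)
      then show ?thesis by (simp add: boundary_def)
    qed
    ultimately obtain v where v: "chain ?L (Suc n) v" "boundary U v = w"
      using L n(2) unfolding acyclic_below_def by blast
    define ev where "ev t = (if e \<subseteq> t then v (t - e) else 0)" for t
    have ev: "t \<in> K" "card t = Suc (Suc d)" if "ev t = 1" for t
    proof -
      have "e \<subseteq> t" "v (t - e) = 1" using that by (auto simp: ev_def split: if_splits)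
      then have "t - e \<in> ?L" "card (t - e) = Suc n" "t = (t - e) \<union> e"
        using v(1) by (auto simp: chain_def)
      then show "t \<in> K" "card t = Suc (Suc d)"
        using n fin [of t] fe card_Un_disjoint [of "t - e" e] by auto
    qed
    define y' where "y' s = y s + boundary U ev s" for s
    have "y' t = 0" if "e \<subseteq> t" for t
    proof -
      have "boundary U ev t = (\<Sum>x\<in>U - t. v (insert x (t - e)))"
        unfolding boundary_def using that
        by (intro sum.cong) (auto simp: ev_def insert_Diff_if)
      \<comment> \<open>The right-hand side also ranges over \<open>x\<close> in \<open>e\<close>,
        where \<open>v\<close> contributes nothing because its simplices avoid
        \<open>e\<close>.\<close>
      also have "\<dots> = boundary U v (t - e)"
        unfolding boundary_def
      proof (intro sum.mono_neutral_left ballI)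
        fix x assume "x \<in> U - (t - e) - (U - t)"
        then have "insert x (t - e) \<inter> e \<noteq> {}" by auto
        then show "v (insert x (t - e)) = 0"
          using v(1) unfolding chain_def by (metis (mono_tags, lifting) bit_not_zero_iff mem_Collect_eq)
      qed (use U in auto)
      also have "\<dots> = y t" using that by (simp add: v(2) w_def Un_absorb2 Int_commute)
      finally show ?thesis by (simp add: y'_def)
    qed
    moreover have "t \<in> K \<and> card t = Suc d" if "y' t = 1" for t
    proof (cases "y t = 1")
      case True
      then show ?thesis using y(1) by (auto simp: chain_def)
    next
      case False
      then have "boundary U ev t = 1" using that by (simp add: y'_def)
      then obtain x where x: "x \<in> U - t" "ev (insert x t) = 1"
        unfolding boundary_def by (rule bit_sum_eq_1E)
      with ev [of "insert x t"] have K: "insert x t \<in> K" "card (insert x t) = Suc (Suc d)" by auto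
      then show ?thesis using x fin [of "insert x t"] down [of "insert x t" t] by auto
    qed
    ultimately have "chain ?K (Suc d) y'" by (fastforce simp: chain_def)
    moreover have "boundary U y' = z"
      by (rule ext) (simp add: y'_def [abs_def] boundary_add boundary_boundary U y(2))
    ultimately show ?thesis by blast
  qed
qed

subsection \<open>Independence complexes of hypergraphs of maximum degree three\<close>

definition indep :: "'a set \<Rightarrow> 'a set set \<Rightarrow> 'a set set" where
  "indep V E = {s. s \<subseteq> V \<and> (\<forall>e\<in>E. \<not> e \<subseteq> s)}"

text \<open>Edges with the same trace outside \<open>e\<close> merge, which can only lower degrees
  and weights.\<close>

definition contract :: "'a set set \<Rightarrow> 'a set \<Rightarrow> 'a set set" where
  "contract E e = (\<lambda>f. f - e) ` (E - {e})"

definition degree :: "'a set set \<Rightarrow> 'a \<Rightarrow> nat" where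
  "degree E v = card {e \<in> E. v \<in> e}"

text \<open>Adding \<open>e\<close> as an edge removes the star of \<open>e\<close> from the complex
  of \<open>E - {e}\<close>. The link of \<open>e\<close> there is the complex of the contracted
  hypergraph, since \<open>s \<union> e\<close> contains \<open>f\<close> exactly when
  \<open>s\<close> contains \<open>f - e\<close>.\<close>

lemma acyclic_below_indep:
  assumes "finite U" and "V \<subseteq> U" and "e \<in> E" and "e \<subseteq> V"
    and "acyclic_below U (indep V (E - {e})) k"
    and "acyclic_below U (indep (V - e) (contract E e)) (k + 1 - card e)"
  shows "acyclic_below U (indep V E) k"
proof -
  have "{s. s \<inter> e = {} \<and> s \<union> e \<in> indep V (E - {e})} = indep (V - e) (contract E e)"
    using assms(4) unfolding indep_def contract_def by (auto simp: Diff_subset_conv Un_commute)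
  moreover have "{s \<in> indep V (E - {e}). \<not> e \<subseteq> s} = indep V E"
    using assms(3) by (auto simp: indep_def)
  moreover have "acyclic_below U {s \<in> indep V (E - {e}). \<not> e \<subseteq> s} k"
  proof (rule acyclic_below_remove_star)
    show "t \<in> indep V (E - {e})" if "s \<in> indep V (E - {e})" "t \<subseteq> s" for s t
      using that unfolding indep_def by blast
    show "indep V (E - {e}) \<subseteq> Pow U" using assms(2) by (auto simp: indep_def)
  qed (use assms calculation(1) in auto)
  ultimately show ?thesis by simp
qed

text \<open>A vertex on no edge can join every independent set, so the complex is a cone.\<close>

lemma acyclic_below_indep_isolated:
  assumes "finite U" and "V \<subseteq> U" and "v \<in> V" and "\<And>e. e \<in> E \<Longrightarrow> v \<notin> e"
  shows "acyclic_below U (indep V E) k"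
proof (rule acyclic_below_cone)
  show "insert v s \<in> indep V E \<and> finite s" if "s \<in> indep V E" for s
    using that assms by (auto simp: indep_def subset_insert intro: finite_subset [of s U])
qed (use assms in auto)

lemma acyclic_below_indep_empty:
  assumes "{} \<in> E"
  shows "acyclic_below U (indep V E) k"
proof -
  have "indep V E = {}" using assms by (auto simp: indep_def)
  then show ?thesis by (simp add: acyclic_below_void)
qed

section \<open>Degrees and weights under deletion and contraction\<close>

lemma degree_mono:
  assumes "finite E" and "F \<subseteq> E"
  shows "degree F v \<le> degree E v"
  using assms unfolding degree_def by (intro card_mono) auto

lemma degree_contract_le:
  assumes "finite E"
  shows "degree (contract E e) v \<le> degree E v"
proof -
  have "{f \<in> contract E e. v \<in> f} \<subseteq> (\<lambda>f. f - e) ` {f \<in> E. v \<in> f}"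
    by (auto simp: contract_def)
  then show ?thesis
    unfolding degree_def using assms by (intro surj_card_le) auto
qed

lemma sum_degree:
  assumes "finite V" and "finite E"
  shows "(\<Sum>v\<in>V. degree E v) = (\<Sum>e\<in>E. card (e \<inter> V))"
proof -
  have "(\<Sum>v\<in>V. degree E v) = (\<Sum>v\<in>V. \<Sum>e\<in>E. of_bool (v \<in> e))"
    unfolding degree_def using assms(2)
    by (intro sum.cong) (auto simp: Int_def)
  also have "\<dots> = (\<Sum>e\<in>E. \<Sum>v\<in>V. of_bool (v \<in> e))"
    by (rule sum.swap)
  also have "\<dots> = (\<Sum>e\<in>E. card (e \<inter> V))"
    using assms(1) by (intro sum.cong) (auto simp: Int_def conj_commute)
  finally show ?thesis .
qed

text \<open>Edges with \<open>n\<close> or more vertices are free. Taking \<open>n = 3\<close> suits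
  hypergraphs of rank three; for graphs without leaves, \<open>n = 2\<close> makes pairs free as
  well.\<close>

definition weight :: "nat \<Rightarrow> 'a set set \<Rightarrow> nat" where
  "weight n E = (\<Sum>e\<in>E. n - card e)"

lemma weight_remove:
  assumes "finite E" and "e \<in> E"
  shows "weight n E = (n - card e) + weight n (E - {e})"
  unfolding weight_def using assms by (rule sum.remove)

text \<open>An edge \<open>f\<close> other than \<open>e\<close> gains at most
  \<open>card (f \<inter> e)\<close>. Double counting turns the total gain into the degrees of the
  vertices of \<open>e\<close>, each reduced by one because \<open>e\<close> itself is gone.\<close>

lemma weight_contract_le:
  assumes "finite E" and "e \<in> E" and "finite e"
  shows "weight n (contract E e) \<le> weight n (E - {e}) + (\<Sum>v\<in>e. degree E v - 1)"
proof -
  have "weight n (contract E e) \<le> (\<Sum>f\<in>E - {e}. n - card (f - e))"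
    unfolding weight_def contract_def using assms(1)
    using sum_image_le [of "E - {e}" "\<lambda>f. n - card f" "\<lambda>f. f - e"] by (simp add: o_def)
  also have "\<dots> \<le> (\<Sum>f\<in>E - {e}. (n - card f) + card (f \<inter> e))"
  proof (rule sum_mono)
    fix f
    have "card f \<le> card (f - e) + card (f \<inter> e)"
      by (metis Int_Diff_Un Un_commute card_Un_le)
    then show "n - card (f - e) \<le> (n - card f) + card (f \<inter> e)" by linarith
  qed
  also have "\<dots> = weight n (E - {e}) + (\<Sum>v\<in>e. degree (E - {e}) v)"
    using assms by (simp add: weight_def sum.distrib sum_degree)
  also have "(\<Sum>v\<in>e. degree (E - {e}) v) = (\<Sum>v\<in>e. degree E v - 1)"
  proof (rule sum.cong)
    fix v assume "v \<in> e"
    then have "{f \<in> E - {e}. v \<in> f} = {f \<in> E. v \<in> f} - {e}" "e \<in> {f \<in> E. v \<in> f}"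
      using assms by auto
    then show "degree (E - {e}) v = degree E v - 1"
      unfolding degree_def by (simp add: card_Diff_singleton)
  qed simp
  finally show ?thesis .
qed

lemma card_contract_less:
  assumes "finite E" and "e \<in> E"
  shows "card (contract E e) < card E"
proof -
  have "card (contract E e) \<le> card (E - {e})"
    unfolding contract_def using assms(1) by (intro card_image_le) simp
  also have "\<dots> < card E" using assms by (rule card_Diff1_less)
  finally show ?thesis .
qed

definition hypergraph :: "nat \<Rightarrow> 'a set \<Rightarrow> 'a set set \<Rightarrow> bool" where
  "hypergraph r V E \<longleftrightarrow> finite V \<and> E \<subseteq> Pow V \<and> (\<forall>e\<in>E. card e \<le> r) \<and> (\<forall>v. degree E v \<le> 3)"

lemma hypergraph_finite:
  assumes "hypergraph r V E"
  shows "finite V" and "finite E" and "e \<in> E \<Longrightarrow> finite e"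
proof -
  show V: "finite V" using assms by (simp add: hypergraph_def)
  have "E \<subseteq> Pow V" using assms by (simp add: hypergraph_def)
  then show "finite E" "e \<in> E \<Longrightarrow> finite e"
    using V finite_subset [of E "Pow V"] finite_subset [of e V] by auto
qed

lemma hypergraph_remove:
  assumes "hypergraph r V E"
  shows "hypergraph r V (E - {e})"
proof -
  have "degree (E - {e}) v \<le> 3" for v
    using degree_mono [of E "E - {e}" v] assms hypergraph_finite(2) [OF assms]
    by (force simp: hypergraph_def intro: order_trans)
  then show ?thesis using assms by (auto simp: hypergraph_def)
qed

lemma hypergraph_contract:
  assumes "hypergraph r V E"
  shows "hypergraph r (V - e) (contract E e)"
proof -
  have "degree (contract E e) v \<le> 3" for v
    using degree_contract_le [of E e v] assms hypergraph_finite(2) [OF assms]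
    by (force simp: hypergraph_def intro: order_trans)
  moreover have "card (f - e) \<le> r" if "f \<in> E" for f
    using that assms hypergraph_finite(3) [OF assms that] card_mono [of f "f - e"]
    by (force simp: hypergraph_def intro: order_trans)
  ultimately show ?thesis using assms by (auto simp: hypergraph_def contract_def)
qed

text \<open>
  In the next three lemmas, contracting an edge \<open>e\<close> costs \<open>card e\<close> vertices and, by the degree bound,
  raises the weight by at most two for each vertex of \<open>e\<close>. Contraction may produce singletons, which
  delete vertices, and even the empty edge, whose complex is void and hence acyclic.
\<close>

lemma acyclic_below_graph_card:
  assumes "finite U" and "V \<subseteq> U" and "hypergraph 2 V E" and "6 * k + weight 2 E \<le> card V"
  shows "acyclic_below U (indep V E) k"
  using assms(2-)
proof (induction "card E" arbitrary: V E k rule: less_induct)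
  case less
  note fin = hypergraph_finite [OF less.prems(2)]
  consider "k = 0" | "{} \<in> E" | (pair) e where "e \<in> E" "card e = 2" "k > 0"
    | (single) "k > 0" "\<And>e. e \<in> E \<Longrightarrow> card e = 1"
  proof -
    have "card e = 1" if "e \<in> E" "{} \<notin> E" "card e \<noteq> 2" for e
      using that less.prems(2) fin(3) [of e] card_0_eq [of e]
      by (auto simp: hypergraph_def le_Suc_eq numeral_2_eq_2)
    then show ?thesis using that by blast
  qed
  then show ?case
  proof cases
    case pair
    have e: "e \<subseteq> V" using pair less.prems(2) by (auto simp: hypergraph_def)
    have "degree E v \<le> 3" for v using less.prems(2) by (simp add: hypergraph_def)
    then have "(\<Sum>v\<in>e. degree E v - 1) \<le> card e * 2"
      using sum_bounded_above [of e "\<lambda>v. degree E v - 1" 2] by (simp add: le_diff_conv)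
    then have w: "weight 2 (contract E e) \<le> weight 2 E + 4"
      using weight_contract_le [of E e 2] weight_remove [of E e 2] fin pair by simp
    have cV: "card (V - e) + 2 = card V"
      using e fin pair card_mono [of V e] by (simp add: card_Diff_subset)
    have "acyclic_below U (indep (V - e) (contract E e)) (k - 1)"
    proof (rule less.hyps)
      \<comment> \<open>An exact balance: two vertices are lost and the weight grows by at most
        four, while the target drops by one, worth six.\<close>
      show "6 * (k - 1) + weight 2 (contract E e) \<le> card (V - e)"
        using w cV less.prems(3) pair by linarith
    qed (use less.prems card_contract_less fin pair hypergraph_contract in auto)
    moreover have "acyclic_below U (indep V (E - {e})) k"
    proof (rule less.hyps)
      show "card (E - {e}) < card E" by (rule card_Diff1_less [OF fin(2) pair(1)])
      show "6 * k + weight 2 (E - {e}) \<le> card V"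
        using less.prems(3) weight_remove [of E e 2] fin pair by simp
    qed (use less.prems hypergraph_remove in auto)
    ultimately show ?thesis
      using acyclic_below_indep [OF assms(1) less.prems(1) pair(1) e] pair by simp
  next
    case single
    \<comment> \<open>Every remaining edge is a singleton of weight one, and \<open>k > 0\<close>
      makes the total weight smaller than \<open>card V\<close>. Hence some vertex is uncovered and
      the complex is a cone.\<close>
    have "card (\<Union>E) \<le> (\<Sum>e\<in>E. card e)"
      using fin(3) by (intro card_Union_le_sum_card)
    also have "\<dots> = weight 2 E"
      unfolding weight_def using single by (intro sum.cong) auto
    also have "\<dots> < card V" using single less.prems(3) by linarith
    finally have "\<not> V \<subseteq> \<Union>E"
      using fin card_mono [of "\<Union>E" V] by (auto simp: not_le)
    then obtain v where "v \<in> V" "\<And>e. e \<in> E \<Longrightarrow> v \<notin> e" by blast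
    then show ?thesis
      using acyclic_below_indep_isolated assms(1) less.prems(1) by metis
  qed (auto intro: acyclic_below_indep_empty)
qed

lemma acyclic_below_graph:
  assumes "finite U" and "V \<subseteq> U" and "hypergraph 2 V E" and "6 * k + weight 3 E \<le> 2 * card V"
  shows "acyclic_below U (indep V E) k"
  using assms(2-)
proof (induction "card E" arbitrary: V E k rule: less_induct)
  case less
  note fin = hypergraph_finite [OF less.prems(2)]
  have deg3: "degree E v \<le> 3" for v using less.prems(2) by (simp add: hypergraph_def)
  consider "k = 0" | "{} \<in> E" | (single) x where "{x} \<in> E"
    | (isolated) v where "v \<in> V" "degree E v = 0"
    | (leaf) v where "v \<in> V" "degree E v = 1" "k > 0" "\<And>e. e \<in> E \<Longrightarrow> card e = 2"
    | (dense) "\<And>v. v \<in> V \<Longrightarrow> degree E v \<ge> 2" "\<And>e. e \<in> E \<Longrightarrow> card e = 2"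
  proof -
    have "card e = 2" if "e \<in> E" "{} \<notin> E" "\<nexists>x. {x} \<in> E" for e
    proof -
      have "card e \<noteq> 0" "card e \<noteq> 1" using that fin(3) [of e] by (auto simp: card_1_singleton_iff)
      then show ?thesis using that less.prems(2) by (force simp: hypergraph_def)
    qed
    moreover have "degree E v = 0 \<or> degree E v = 1 \<or> degree E v \<ge> 2" for v by linarith
    ultimately show ?thesis using that by (metis not_gr_zero)
  qed
  then show ?case
  proof cases
    case single
    let ?E = "{f \<in> E. x \<notin> f}"
    have x: "x \<in> V" using single less.prems(2) by (auto simp: hypergraph_def)
    \<comment> \<open>The singleton edge bans \<open>x\<close>, so \<open>x\<close> and all edges
      through it can be deleted. This lowers the right side of the bound by two and the weight by at
      least two.\<close>
    have "indep V E = indep (V - {x}) ?E"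
      using single by (force simp: indep_def)
    moreover have "acyclic_below U (indep (V - {x}) ?E) k"
    proof (rule less.hyps)
      show "card ?E < card E" using fin single by (intro psubset_card_mono) auto
      have "degree ?E v \<le> 3" for v
        using degree_mono [of E ?E v] deg3 [of v] fin(2) by auto
      then show "hypergraph 2 (V - {x}) ?E"
        using less.prems(2) by (auto simp: hypergraph_def)
      have "weight 3 ?E \<le> weight 3 (E - {{x}})"
        unfolding weight_def using fin(2) by (intro sum_mono2) auto
      then have "weight 3 ?E + 2 \<le> weight 3 E"
        using weight_remove [of E "{x}" 3] fin(2) single by simp
      then show "6 * k + weight 3 ?E \<le> 2 * card (V - {x})"
        using less.prems(3) x fin(1) card_Suc_Diff1 [of V x] by linarith
    qed (use less.prems in auto)
    ultimately show ?thesis by simp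
  next
    case isolated
    then have "v \<notin> e" if "e \<in> E" for e
      using that fin(2) by (auto simp: degree_def)
    then show ?thesis
      using acyclic_below_indep_isolated assms(1) less.prems(1) isolated(1) by metis
  next
    case leaf
    then obtain e where ve: "{f \<in> E. v \<in> f} = {e}"
      unfolding degree_def using card_1_singletonE by metis
    then have "e \<in> {f \<in> E. v \<in> f}" by simp
    then have e: "e \<in> E" "v \<in> e" by auto
    moreover from e have "e \<subseteq> V" "card e = 2" "finite e"
      using less.prems(2) leaf(4) fin(3) by (auto simp: hypergraph_def)
    ultimately have e: "e \<in> E" "v \<in> e" "e \<subseteq> V" "card e = 2" "finite e" by auto
    \<comment> \<open>Without its only edge the leaf \<open>v\<close> is isolated, so deletion gives
      a cone.\<close>
    have "acyclic_below U (indep V (E - {e})) k"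
      by (rule acyclic_below_indep_isolated [OF assms(1) less.prems(1) leaf(1)]) (use ve in auto)
    moreover have "acyclic_below U (indep (V - e) (contract E e)) (k - 1)"
    proof (rule less.hyps)
      \<comment> \<open>The leaf adds no weight and its neighbour at most two, while
        \<open>e\<close> takes away its own weight one. The net gain is at most one, where two would
        be affordable.\<close>
      have "(\<Sum>u\<in>e. degree E u - 1) = (\<Sum>u\<in>e - {v}. degree E u - 1)"
        using e leaf by (simp add: sum.remove [of e v])
      also have "\<dots> \<le> card (e - {v}) * 2"
        using deg3 sum_bounded_above [of "e - {v}" "\<lambda>v. degree E v - 1" 2]
        by (simp add: le_diff_conv)
      finally have "weight 3 (contract E e) \<le> weight 3 E + 1"
        using weight_contract_le [of E e 3] weight_remove [of E e 3] fin e by simp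
      moreover have "card (V - e) + 2 = card V"
        using e fin card_mono [of V e] by (simp add: card_Diff_subset)
      ultimately show "6 * (k - 1) + weight 3 (contract E e) \<le> 2 * card (V - e)"
        using less.prems(3) leaf(3) by linarith
    qed (use less.prems card_contract_less fin e hypergraph_contract in auto)
    ultimately show ?thesis
      using acyclic_below_indep [OF assms(1) less.prems(1) e(1,3)] e(4) by simp
  next
    case dense
    \<comment> \<open>Double counting gives \<open>card V <= card E\<close>. The weight for
      \<open>n = 3\<close> is \<open>card E\<close>, so
      \<open>6 * k <= 2 * card V - card E <= card V\<close>, as the previous lemma requires.\<close>
    have "card V * 2 \<le> (\<Sum>v\<in>V. degree E v)"
      using dense sum_bounded_below [of V 2 "degree E"] by simp
    also have "\<dots> = (\<Sum>e\<in>E. card e)"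
      using less.prems(2) fin sum_degree [of V E]
      by (auto simp: hypergraph_def Int_absorb2 intro!: sum.cong)
    also have "\<dots> = 2 * card E" using dense by simp
    finally have "card V \<le> card E" by simp
    moreover have "weight 3 E = card E" "weight 2 E = 0"
      using dense by (auto simp: weight_def)
    ultimately show ?thesis
      using acyclic_below_graph_card [OF assms(1) less.prems(1,2)] less.prems(3) by simp
  qed (auto intro: acyclic_below_indep_empty)
qed

lemma acyclic_below_hypergraph:
  assumes "finite U" and "V \<subseteq> U" and "hypergraph 3 V E" and "6 * k + weight 3 E \<le> 2 * card V"
  shows "acyclic_below U (indep V E) k"
  using assms(2-)
proof (induction "card E" arbitrary: V E k rule: less_induct)
  case less
  note fin = hypergraph_finite [OF less.prems(2)]
  show ?case
  proof (cases "\<exists>e\<in>E. card e = 3")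
    case False
    then have "card e \<le> 2" if "e \<in> E" for e
      using that less.prems(2) by (force simp: hypergraph_def)
    then have "hypergraph 2 V E" using less.prems(2) by (simp add: hypergraph_def)
    then show ?thesis using acyclic_below_graph less.prems assms(1) by blast
  next
    case True
    then obtain e where e: "e \<in> E" "card e = 3" by blast
    have eV: "e \<subseteq> V" using e less.prems(2) by (auto simp: hypergraph_def)
    have "acyclic_below U (indep (V - e) (contract E e)) (k - 2)"
    \<comment> \<open>For \<open>k <= 2\<close> the truncated difference is 0 and nothing is
      claimed; otherwise the target really drops by two, as the count needs.\<close>
    proof (cases "k \<le> 2")
      case False
      show ?thesis
      proof (rule less.hyps)
        have "degree E v \<le> 3" for v using less.prems(2) by (simp add: hypergraph_def)
        then have "(\<Sum>v\<in>e. degree E v - 1) \<le> card e * 2"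
          using sum_bounded_above [of e "\<lambda>v. degree E v - 1" 2] by (simp add: le_diff_conv)
        then have "weight 3 (contract E e) \<le> weight 3 E + 6"
          using weight_contract_le [of E e 3] weight_remove [of E e 3] fin e by simp
        moreover have "card (V - e) + 3 = card V"
          using e eV fin card_mono [of V e] by (simp add: card_Diff_subset)
        \<comment> \<open>Again an exact balance: the drop of twelve pays for three vertices counted
          twice and a weight gain of six.\<close>
        ultimately show "6 * (k - 2) + weight 3 (contract E e) \<le> 2 * card (V - e)"
          using less.prems(3) False by linarith
      qed (use less.prems card_contract_less fin e hypergraph_contract in auto)
    qed simp
    moreover have "acyclic_below U (indep V (E - {e})) k"
    proof (rule less.hyps)
      show "card (E - {e}) < card E" by (rule card_Diff1_less [OF fin(2) e(1)])
      show "6 * k + weight 3 (E - {e}) \<le> 2 * card V"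
        using less.prems(3) weight_remove [of E e 3] fin e by simp
    qed (use less.prems hypergraph_remove in auto)
    ultimately show ?thesis
      using acyclic_below_indep [OF assms(1) less.prems(1) e(1) eV] e(2) by simp
  qed
qed

subsection \<open>Topological Hall theorem\<close>

definition transversals :: "('i \<Rightarrow> 'a set) \<Rightarrow> 'i set \<Rightarrow> 'a set set" where
  "transversals P I = {s. s \<subseteq> \<Union> (P ` I) \<and> (\<forall>i\<in>I. \<exists>!x. x \<in> s \<and> x \<in> P i)}"

lemma transversals_empty: "transversals P {} = {{}}"
  by (auto simp: transversals_def)

text \<open>The map from \<open>(r, a)\<close> to \<open>insert a r\<close> is a bijection:
  intersecting with \<open>P i\<close> recovers \<open>a\<close>, removing \<open>P i\<close>
  recovers \<open>r\<close>.\<close>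

lemma sum_transversals_insert:
  assumes "disjoint_family_on P (insert i I)" and "i \<notin> I"
  shows "(\<Sum>t\<in>transversals P (insert i I). f t)
    = (\<Sum>r\<in>transversals P I. \<Sum>a\<in>P i. f (insert a r))"
proof -
  have dj: "P j \<inter> P i = {}" if "j \<in> I" for j
    using disjoint_family_onD [OF assms(1), of j i] assms(2) that by auto
  have ar: "insert a r \<in> transversals P (insert i I)" "insert a r \<inter> P i = {a}"
      "insert a r - P i = r"
    if "r \<in> transversals P I" "a \<in> P i" for a r
  proof -
    have r: "r \<subseteq> \<Union> (P ` I)" "\<And>j. j \<in> I \<Longrightarrow> \<exists>!x. x \<in> r \<and> x \<in> P j"
      using that by (auto simp: transversals_def)
    then have rP: "r \<inter> P i = {}" using dj by blast
    then show *: "insert a r \<inter> P i = {a}" "insert a r - P i = r" using that by auto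
    have "\<exists>!x. x \<in> insert a r \<and> x \<in> P j" if "j \<in> insert i I" for j
    proof (cases "j = i")
      case True
      then show ?thesis using * by blast
    next
      case False
      then have "a \<notin> P j" using that \<open>a \<in> P i\<close> dj by blast
      then show ?thesis using r(2) [of j] False that by (metis insert_iff)
    qed
    then show "insert a r \<in> transversals P (insert i I)"
      using r(1) that by (auto simp: transversals_def)
  qed
  have "\<exists>r\<in>transversals P I. \<exists>a\<in>P i. t = insert a r"
    if "t \<in> transversals P (insert i I)" for t
  proof -
    have t: "t \<subseteq> \<Union> (P ` insert i I)" "\<And>j. j \<in> insert i I \<Longrightarrow> \<exists>!x. x \<in> t \<and> x \<in> P j"
      using that by (auto simp: transversals_def)
    obtain a where a: "a \<in> t" "a \<in> P i" "\<And>x. x \<in> t \<Longrightarrow> x \<in> P i \<Longrightarrow> x = a"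
      using t(2) [of i] by blast
    have "\<exists>!x. x \<in> t - {a} \<and> x \<in> P j" if "j \<in> I" for j
    proof -
      have "a \<notin> P j" using dj [OF that] a(2) by blast
      then show ?thesis using t(2) [of j] that by (metis DiffE DiffI insertCI singletonD)
    qed
    moreover have "t - {a} \<subseteq> \<Union> (P ` I)" using t(1) a(3) by auto
    ultimately have "t - {a} \<in> transversals P I" by (simp add: transversals_def)
    moreover have "t = insert a (t - {a})" using a(1) by auto
    ultimately show ?thesis using a(2) by blast
  qed
  then have "(\<lambda>(r, a). insert a r) ` (transversals P I \<times> P i) = transversals P (insert i I)"
    using ar(1) by (auto simp: image_iff)
  moreover have "inj_on (\<lambda>(r, a). insert a r) (transversals P I \<times> P i)"
  proof (intro inj_onI, clarify)
    fix r a r' a'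
    assume *: "r \<in> transversals P I" "a \<in> P i" "r' \<in> transversals P I" "a' \<in> P i"
      and eq: "insert a r = insert a' r'"
    have "{a} = {a'}" "r = r'"
      using ar(2,3) [OF *(1,2)] ar(2,3) [OF *(3,4)] eq by simp_all
    then show "r = r' \<and> a = a'" by simp
  qed
  ultimately have "(\<Sum>t\<in>transversals P (insert i I). f t)
      = (\<Sum>(r, a)\<in>transversals P I \<times> P i. f (insert a r))"
    using sum.reindex [of "\<lambda>(r, a). insert a r" "transversals P I \<times> P i" f]
    by (simp add: case_prod_unfold o_def)
  then show ?thesis by (simp add: sum.cartesian_product)
qed

lemma transversals_disjoint_class:
  assumes "disjoint_family_on P J" and "I \<subseteq> J" and "j \<in> J - I" and "r \<in> transversals P I"
  shows "r \<inter> P j = {}"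
proof -
  have "P i \<inter> P j = {}" if "i \<in> I" for i
    using that assms(2,3) by (intro disjoint_family_onD [OF assms(1)]) auto
  then show ?thesis using assms(4) unfolding transversals_def by blast
qed

text \<open>
  Sperner-type parity argument: adding to a transversal of \<open>J - {j}\<close> a second vertex of one of its own
  classes gives a set that arises in exactly two ways, so only vertices of class \<open>j\<close> contribute.
\<close>

lemma sum_boundary_transversals:
  assumes U: "finite U" "\<And>j. j \<in> J \<Longrightarrow> P j \<subseteq> U" and dj: "disjoint_family_on P J"
    and "finite J" and j: "j \<in> J" and c: "\<And>s. c s = 1 \<Longrightarrow> s \<subseteq> \<Union> (P ` J)"
  shows "(\<Sum>t\<in>transversals P (J - {j}). boundary U c t) = (\<Sum>s\<in>transversals P J. c s)"
proof -
  let ?R = "transversals P (J - {j})"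
  have "boundary U c t = (\<Sum>i\<in>J. \<Sum>x\<in>P i - t. c (insert x t))" for t
  proof -
    have "boundary U c t = (\<Sum>x\<in>(\<Union>i\<in>J. P i - t). c (insert x t))"
      unfolding boundary_def
    proof (intro sum.mono_neutral_right ballI)
      fix x assume "x \<in> U - t - (\<Union>i\<in>J. P i - t)"
      then have "\<not> insert x t \<subseteq> \<Union> (P ` J)" by auto
      then show "c (insert x t) = 0" using c by (metis bit_not_zero_iff)
    qed (use U in auto)
    also have "\<dots> = (\<Sum>i\<in>J. \<Sum>x\<in>P i - t. c (insert x t))"
    proof (intro sum.UNION_disjoint ballI impI)
      show "(P i - t) \<inter> (P i' - t) = {}" if "i \<in> J" "i' \<in> J" "i \<noteq> i'" for i i'
        using disjoint_family_onD [OF dj that] by auto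
      show "finite (P i - t)" if "i \<in> J" for i
        using U(2) [OF that] U(1) finite_subset by auto
    qed (use \<open>finite J\<close> in auto)
    finally show ?thesis .
  qed
  then have "(\<Sum>t\<in>?R. boundary U c t) = (\<Sum>i\<in>J. \<Sum>t\<in>?R. \<Sum>x\<in>P i - t. c (insert x t))"
    by (simp add: sum.swap [of _ J])
  also have "\<dots> = (\<Sum>t\<in>?R. \<Sum>x\<in>P j - t. c (insert x t))
      + (\<Sum>i\<in>J - {j}. \<Sum>t\<in>?R. \<Sum>x\<in>P i - t. c (insert x t))"
    using \<open>finite J\<close> j by (rule sum.remove)
  also have "(\<Sum>i\<in>J - {j}. \<Sum>t\<in>?R. \<Sum>x\<in>P i - t. c (insert x t)) = 0"
  proof (rule sum.neutral, rule ballI)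
    fix i assume i: "i \<in> J - {j}"
    let ?I = "J - {j} - {i}"
    have I: "insert i ?I = J - {j}" using i by auto
    have "(\<Sum>t\<in>transversals P (insert i ?I). \<Sum>x\<in>P i - t. c (insert x t))
        = (\<Sum>r\<in>transversals P ?I. \<Sum>a\<in>P i. \<Sum>x\<in>P i - insert a r. c (insert x (insert a r)))"
    proof (rule sum_transversals_insert)
      show "disjoint_family_on P (insert i ?I)"
        using i by (intro disjoint_family_on_mono [OF _ dj]) auto
    qed simp
    also have "\<dots> = (\<Sum>r\<in>transversals P ?I. \<Sum>a\<in>P i. \<Sum>x\<in>P i - {a}. c (insert x (insert a r)))"
    proof (intro sum.cong refl)
      fix r a assume "r \<in> transversals P ?I"
      then have "r \<inter> P i = {}" using transversals_disjoint_class [OF dj, of ?I i] i by blast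
      then show "P i - insert a r = P i - {a}" by auto
    qed
    also have "\<dots> = 0"
    proof (rule sum.neutral, rule ballI)
      fix r assume "r \<in> transversals P ?I"
      have "finite (P i)" using i U(1) U(2) [of i] finite_subset by auto
      then show "(\<Sum>a\<in>P i. \<Sum>x\<in>P i - {a}. c (insert x (insert a r))) = 0"
        by (rule bit_sum_symmetric) (simp add: insert_commute)
    qed
    finally show "(\<Sum>t\<in>?R. \<Sum>x\<in>P i - t. c (insert x t)) = 0" by (simp only: I)
  qed
  also have "(\<Sum>t\<in>?R. \<Sum>x\<in>P j - t. c (insert x t)) = (\<Sum>t\<in>?R. \<Sum>x\<in>P j. c (insert x t))"
  proof (intro sum.cong refl)
    fix t assume "t \<in> ?R"
    then have "t \<inter> P j = {}" using transversals_disjoint_class [OF dj, of "J - {j}" j] j by blast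
    then show "P j - t = P j" by auto
  qed
  also have "\<dots> = (\<Sum>s\<in>transversals P (insert j (J - {j})). c s)"
    using dj j by (intro sum_transversals_insert [symmetric]) (auto simp: insert_absorb)
  finally show ?thesis using j by (simp add: insert_absorb)
qed

text \<open>An acyclic carrier argument. The \<open>c J\<close> form a chain map from the simplex on
  \<open>M\<close>, sending each face \<open>J\<close> into the subcomplex on its classes. It is
  built by increasing \<open>card J\<close>: the images of the facets of \<open>J\<close> sum to a
  cycle, which is then filled.\<close>

lemma compatible_fillings_exist:
  assumes "finite U" and "finite M" and "{} \<in> K"
    and ac: "\<And>J. J \<subseteq> M \<Longrightarrow> acyclic_below U (K \<inter> Pow (\<Union> (P ` J))) (card J)"
  shows "\<exists>c. \<forall>J\<subseteq>M. chain (K \<inter> Pow (\<Union> (P ` J))) (card J) (c J) \<and>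
    (\<forall>s. J \<noteq> {} \<longrightarrow> boundary U (c J) s = (\<Sum>j\<in>J. c (J - {j}) s)) \<and> c {} {} = 1"
proof -
  let ?K = "\<lambda>J. K \<inter> Pow (\<Union> (P ` J))"
  define good where "good c J \<longleftrightarrow> chain (?K J) (card J) (c J) \<and>
    (\<forall>s. J \<noteq> {} \<longrightarrow> boundary U (c J) s = (\<Sum>j\<in>J. c (J - {j}) s)) \<and> c {} {} = 1" for c J
  have "\<exists>c. \<forall>J\<subseteq>M. card J \<le> n \<longrightarrow> good c J" for n
  proof (induction n)
    case 0
    \<comment> \<open>The empty face goes to the empty simplex.\<close>
    have "good (\<lambda>J s. if s = {} then 1 else 0) {}"
      using assms(3) by (auto simp: good_def chain_def)
    moreover have "J = {}" if "J \<subseteq> M" "card J \<le> 0" for J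
      using that assms(2) finite_subset by fastforce
    ultimately show ?case by metis
  next
    case (Suc n)
    then obtain c where c: "\<And>J. J \<subseteq> M \<Longrightarrow> card J \<le> n \<Longrightarrow> good c J" by blast
    have "\<exists>y. chain (?K J) (Suc n) y \<and> boundary U y = (\<lambda>s. \<Sum>j\<in>J. c (J - {j}) s)"
      if J: "J \<subseteq> M" "card J = Suc n" for J
    proof -
      let ?z = "\<lambda>s. \<Sum>j\<in>J. c (J - {j}) s"
      have fJ: "finite J" using J by (metis card.infinite nat.distinct(1))
      have g: "good c (J - {j})" "card (J - {j}) = n" if "j \<in> J" for j
        using that J fJ by (auto intro!: c)
      have "chain (?K J) n ?z"
        unfolding chain_def
      proof (intro allI impI)
        fix s assume "?z s = 1"
        then obtain j where j: "j \<in> J" "c (J - {j}) s = 1"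
          by (rule bit_sum_eq_1E)
        then have "s \<in> ?K (J - {j})" "card s = n"
          using g [OF j(1)] unfolding good_def chain_def by auto
        then show "s \<in> ?K J \<and> card s = n" by auto
      qed
      moreover have "boundary U ?z s = 0" for s
      proof (cases "n = 0")
        \<comment> \<open>The boundary equation excludes the empty face, so this case is separate:
          \<open>?z\<close> is supported on the empty simplex, and boundaries only read nonempty
          sets.\<close>
        case True
        then obtain j where "J = {j}" using J card_1_singletonE by (metis One_nat_def)
        then have "?z = c {}" by (simp add: fun_eq_iff)
        then have "chain (?K {}) 0 ?z" using g [of j] \<open>J = {j}\<close> True by (simp add: good_def)
        then have "?z (insert x s) = 0" for x
          unfolding chain_def by auto
        then show ?thesis by (simp add: boundary_def)
      next
        case False
        have "boundary U ?z s = (\<Sum>j\<in>J. boundary U (c (J - {j})) s)"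
          unfolding boundary_def by (rule sum.swap)
        also have "\<dots> = (\<Sum>j\<in>J. \<Sum>i\<in>J - {j}. c (J - {j} - {i}) s)"
        proof (intro sum.cong refl)
          fix j assume "j \<in> J"
          moreover have "J - {j} \<noteq> {}" using g(2) [OF \<open>j \<in> J\<close>] False by (metis card.empty)
          ultimately show "boundary U (c (J - {j})) s = (\<Sum>i\<in>J - {j}. c (J - {j} - {i}) s)"
            using g(1) unfolding good_def by blast
        qed
        also have "\<dots> = 0"
          using fJ by (intro bit_sum_symmetric) (auto simp: Diff_insert2 [symmetric] insert_commute)
        finally show ?thesis .
      qed
      \<comment> \<open>Acyclicity below \<open>card J = n + 1\<close> is used in its top degree
        \<open>n\<close>.\<close>
      ultimately show ?thesis
        using ac [OF J(1)] J(2) unfolding acyclic_below_def by (metis lessI)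
    qed
    then obtain y where y: "\<And>J. J \<subseteq> M \<Longrightarrow> card J = Suc n \<Longrightarrow>
        chain (?K J) (Suc n) (y J) \<and> boundary U (y J) = (\<lambda>s. \<Sum>j\<in>J. c (J - {j}) s)"
      by metis
    \<comment> \<open>Only faces of size \<open>n + 1\<close> are redefined, so the equations for
      smaller faces persist.\<close>
    define c' where "c' J = (if card J = Suc n then y J else c J)" for J
    have "good c' J" if J: "J \<subseteq> M" "card J \<le> Suc n" for J
    proof -
      have fJ: "finite J" using J(1) assms(2) finite_subset by blast
      have "c' (J - {j}) = c (J - {j})" if "j \<in> J" for j
        using that J(2) fJ by (auto simp: c'_def dest: card_gt_0_iff [THEN iffD2])
      moreover have "c' {} = c {}" by (simp add: c'_def)
      moreover have "good c {}" by (intro c) auto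
      ultimately show ?thesis
        using y [OF J(1)] c [OF J(1)] J(2)
        by (auto simp: good_def c'_def le_Suc_eq intro!: sum.cong)
    qed
    then show ?case by blast
  qed
  then obtain c where "\<And>J. J \<subseteq> M \<Longrightarrow> card J \<le> card M \<Longrightarrow> good c J" by blast
  then show ?thesis
    using card_mono [OF assms(2)] unfolding good_def by blast
qed

text \<open>By induction on \<open>J\<close>, the support of the compatible filling
  \<open>c J\<close> contains an odd number of transversals of \<open>J\<close>. For
  \<open>J = M\<close> there is thus at least one, and the support lies in \<open>K\<close>.\<close>

lemma topological_hall:
  assumes U: "finite U" "\<And>j. j \<in> M \<Longrightarrow> P j \<subseteq> U" and "finite M" and dj: "disjoint_family_on P M"
    and "{} \<in> K"
    and "\<And>J. J \<subseteq> M \<Longrightarrow> acyclic_below U (K \<inter> Pow (\<Union> (P ` J))) (card J)"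
  shows "transversals P M \<inter> K \<noteq> {}"
proof -
  obtain c where c: "\<And>J. J \<subseteq> M \<Longrightarrow> chain (K \<inter> Pow (\<Union> (P ` J))) (card J) (c J)"
      "\<And>J s. J \<subseteq> M \<Longrightarrow> J \<noteq> {} \<Longrightarrow> boundary U (c J) s = (\<Sum>j\<in>J. c (J - {j}) s)"
      "c {} {} = 1"
    using compatible_fillings_exist [of U M K P] assms by (metis empty_subsetI)
  have "(\<Sum>s\<in>transversals P J. c J s) = 1" if "finite J" "J \<subseteq> M" for J
    using that
  proof (induction J)
    case empty
    then show ?case by (simp add: transversals_empty c(3))
  next
    case (insert j J)
    let ?J = "insert j J"
    \<comment> \<open>The transversal \<open>t\<close> has a vertex in class \<open>i\<close>, but
      \<open>c (?J - {i})\<close> lives on the other classes. So on \<open>t\<close> the boundary of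
      \<open>c ?J\<close> reduces to its summand \<open>c J\<close>.\<close>
    have "c (?J - {i}) t = 0" if "i \<in> J" "t \<in> transversals P J" for i t
    proof -
      have "\<exists>x. x \<in> t \<and> x \<in> P i" using that by (auto simp: transversals_def)
      moreover have "P i \<inter> P i' = {}" if "i' \<in> ?J - {i}" for i'
        using that \<open>i \<in> J\<close> insert.prems by (intro disjoint_family_onD [OF dj]) auto
      ultimately have "\<not> t \<subseteq> \<Union> (P ` (?J - {i}))" by blast
      then show ?thesis
        using c(1) [of "?J - {i}"] insert.prems unfolding chain_def by fastforce
    qed
    then have "boundary U (c ?J) t = c J t" if "t \<in> transversals P J" for t
      using c(2) [of ?J t] insert that by simp
    then have "(\<Sum>s\<in>transversals P J. c J s) = (\<Sum>t\<in>transversals P (?J - {j}). boundary U (c ?J) t)"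
      using insert by simp
    also have "\<dots> = (\<Sum>s\<in>transversals P ?J. c ?J s)"
    proof (rule sum_boundary_transversals)
      show "disjoint_family_on P ?J"
        using dj insert.prems by (rule disjoint_family_on_mono [rotated])
      show "s \<subseteq> \<Union> (P ` ?J)" if "c ?J s = 1" for s
        using that c(1) [of ?J] insert.prems unfolding chain_def by blast
    qed (use U insert in auto)
    finally show ?case using insert by simp
  qed
  then have "(\<Sum>s\<in>transversals P M. c M s) = 1" using \<open>finite M\<close> by blast
  then obtain s where "s \<in> transversals P M" "c M s = 1"
    by (rule bit_sum_eq_1E)
  then show ?thesis using c(1) [of M] unfolding chain_def by auto
qed

lemma independent_transversal_exists:
  assumes M: "finite M" "disjoint_family_on P M" "\<And>j. j \<in> M \<Longrightarrow> card (P j) = 3"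
    and E: "finite E" "\<And>e. e \<in> E \<Longrightarrow> card e = 3" "\<And>v. degree E v \<le> 3"
  shows "\<exists>s\<in>transversals P M. \<forall>e\<in>E. \<not> e \<subseteq> s"
proof -
  define U where "U = \<Union> (P ` M)"
  have finP: "finite (P j)" if "j \<in> M" for j
    using M(3) [OF that] card.infinite by fastforce
  have "finite U" using M(1) finP by (simp add: U_def)
  have "acyclic_below U (indep U E \<inter> Pow (\<Union> (P ` J))) (card J)" if J: "J \<subseteq> M" for J
  proof -
    let ?V = "\<Union> (P ` J)" and ?E = "{e \<in> E. e \<subseteq> \<Union> (P ` J)}"
    have "?V \<subseteq> U" using J by (auto simp: U_def)
    have "card ?V = (\<Sum>j\<in>J. card (P j))"
      using J M(2) finP finite_subset [OF J M(1)]
      by (intro card_UN_disjoint) (auto simp: disjoint_family_on_def)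
    also have "\<dots> = 3 * card J" using J M(3) by (simp add: subset_iff)
    \<comment> \<open>This holds with equality: triples have weight 0, and each class of three
      vertices contributes six on the right.\<close>
    finally have "6 * card J + weight 3 ?E \<le> 2 * card ?V"
      using E(2) by (simp add: weight_def)
    moreover have "degree ?E v \<le> 3" for v
      by (rule order.trans [OF degree_mono [OF E(1)] E(3)]) auto
    then have "hypergraph 3 ?V ?E"
      using E(2) \<open>finite U\<close> \<open>?V \<subseteq> U\<close> finite_subset by (auto simp: hypergraph_def)
    ultimately have "acyclic_below U (indep ?V ?E) (card J)"
      using acyclic_below_hypergraph \<open>finite U\<close> \<open>?V \<subseteq> U\<close> by blast
    moreover have "indep U E \<inter> Pow ?V = indep ?V ?E"
      using \<open>?V \<subseteq> U\<close> unfolding indep_def by blast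
    ultimately show ?thesis by simp
  qed
  moreover have "{} \<in> indep U E" using E(2) by (fastforce simp: indep_def)
  ultimately have "transversals P M \<inter> indep U E \<noteq> {}"
    using topological_hall [of U M P "indep U E"] M \<open>finite U\<close> by (auto simp: U_def)
  then show ?thesis by (auto simp: indep_def)
qed

subsection \<open>Monotone formulas\<close>

lemma clause_vars_iff:
  shows "positive_clause C \<Longrightarrow> x \<in> clause_vars C \<longleftrightarrow> Pos x \<in> C"
    and "negative_clause C \<Longrightarrow> x \<in> clause_vars C \<longleftrightarrow> Neg x \<in> C"
  unfolding positive_clause_def negative_clause_def clause_vars_def
  by (force simp: image_iff)+

text \<open>All literals of a monotone clause have the same sign, so distinct literals have distinct
  variables.\<close>

lemma card_clause_vars:
  assumes "positive_clause C \<or> negative_clause C"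
  shows "card (clause_vars C) = card C"
  unfolding clause_vars_def
proof (rule card_image)
  show "inj_on lit_var C"
  proof (rule inj_onI)
    fix k l assume "k \<in> C" "l \<in> C" "lit_var k = lit_var l"
    then show "k = l"
      using assms unfolding positive_clause_def negative_clause_def by (metis lit_var.simps)
  qed
qed

text \<open>Occurrences count repeated clauses, whereas classes and edges are indexed by distinct
  clauses; forgetting multiplicities only decreases the count.\<close>

lemma card_clauses_le_occurrences:
  "card {C \<in> set_mset F. l \<in> C} \<le> occurrences l F"
proof -
  have "card (set_mset G) \<le> size G" for G :: "'a cnf"
    by (induction G) (auto simp: card_insert_if)
  from this [of "{#C \<in># F. l \<in> C#}"] show ?thesis
    by (simp add: occurrences_def)
qed

theorem theorem1:
  fixes F :: "'a cnf"
  assumes "three_cnf F" and "monotone_cnf F"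
    and "\<forall>x\<in>cnf_vars F. occurrences (Neg x) F = 1"
    and "\<forall>x\<in>cnf_vars F. occurrences (Pos x) F = 3"
  shows "(\<exists>S. satisfying_color_structure F S \<and>
            S \<subseteq> cnf_vars F \<and>
            (\<forall>C\<in>#F. negative_clause C \<longrightarrow> (\<exists>!x. x \<in> S \<and> x \<in> clause_vars C)) \<and>
            (\<forall>C\<in>#F. positive_clause C \<longrightarrow> \<not> clause_vars C \<subseteq> S))
         \<and> satisfiable F"
proof -
  let ?N = "{C \<in> set_mset F. negative_clause C}"
  let ?E = "clause_vars ` {C \<in> set_mset F. positive_clause C}"
  have card3: "card (clause_vars C) = 3" if "C \<in># F" for C
    using that assms(1,2) card_clause_vars [of C] by (simp add: three_cnf_def monotone_cnf_def)
  have "degree ?E v \<le> 3" for v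
  proof (cases "v \<in> cnf_vars F")
    case True
    have "{e \<in> ?E. v \<in> e} \<subseteq> clause_vars ` {C \<in> set_mset F. Pos v \<in> C}"
      by (auto simp: clause_vars_iff(1) intro!: imageI)
    then have "degree ?E v \<le> card {C \<in> set_mset F. Pos v \<in> C}"
      unfolding degree_def by (intro surj_card_le) auto
    then show ?thesis
      using card_clauses_le_occurrences [of F "Pos v"] assms(4) True by force
  next
    case False
    then have none: "{e \<in> ?E. v \<in> e} = {}" by (auto simp: cnf_vars_def)
    show ?thesis unfolding degree_def none by simp
  qed
  moreover have "disjoint_family_on clause_vars ?N"
    unfolding disjoint_family_on_def
  proof (intro ballI impI)
    fix C D assume CD: "C \<in> ?N" "D \<in> ?N" "C \<noteq> D"
    show "clause_vars C \<inter> clause_vars D = {}"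
    proof (rule ccontr)
      assume "clause_vars C \<inter> clause_vars D \<noteq> {}"
      then obtain x where x: "x \<in> clause_vars C" "x \<in> clause_vars D" by blast
      \<comment> \<open>Two negative clauses sharing \<open>x\<close> would make
        \<open>Neg x\<close> occur twice.\<close>
      then have "{C, D} \<subseteq> {C \<in> set_mset F. Neg x \<in> C}"
        using CD by (auto simp: clause_vars_iff(2))
      then have "card {C, D} \<le> card {C \<in> set_mset F. Neg x \<in> C}"
        by (intro card_mono) auto
      then have "card {C, D} \<le> occurrences (Neg x) F"
        using card_clauses_le_occurrences [of F "Neg x"] by linarith
      moreover have "x \<in> cnf_vars F" using x CD by (auto simp: cnf_vars_def)
      ultimately show False using assms(3) CD(3) by simp
    qed
  qed
  ultimately have "\<exists>s\<in>transversals clause_vars ?N. \<forall>e\<in>?E. \<not> e \<subseteq> s"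
    using card3 by (intro independent_transversal_exists) auto
  then obtain S where S: "S \<in> transversals clause_vars ?N" "\<And>e. e \<in> ?E \<Longrightarrow> \<not> e \<subseteq> S"
    by blast
  have sub: "S \<subseteq> cnf_vars F" using S(1) by (auto simp: transversals_def cnf_vars_def)
  have neg: "\<exists>!x. x \<in> S \<and> x \<in> clause_vars C" if "C \<in># F" "negative_clause C" for C
    using S(1) that by (auto simp: transversals_def)
  have pos: "\<not> clause_vars C \<subseteq> S" if "C \<in># F" "positive_clause C" for C
    using S(2) that by blast
  have "satisfying_color_structure F S"
    using sub neg pos unfolding satisfying_color_structure_def color_structure_def colors_def
    by blast
  \<comment> \<open>Exactly the variables of \<open>S\<close> are set to false: a positive clause
    has a variable outside \<open>S\<close>, a negative one has a variable in
    \<open>S\<close>.\<close>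
  moreover have "\<exists>l\<in>C. lit_true (\<lambda>x. x \<notin> S) l" if C: "C \<in># F" for C
  proof (cases "positive_clause C")
    case True
    then obtain x where "x \<in> clause_vars C" "x \<notin> S" using pos C by blast
    then show ?thesis using clause_vars_iff(1) [OF True] by (intro bexI [of _ "Pos x"]) auto
  next
    case False
    then have N: "negative_clause C" using assms(2) C by (auto simp: monotone_cnf_def)
    then obtain x where "x \<in> clause_vars C" "x \<in> S" using neg C by blast
    then show ?thesis using clause_vars_iff(2) [OF N] by (intro bexI [of _ "Neg x"]) auto
  qed
  then have "satisfiable F" unfolding satisfiable_def satisfies_def by blast
  ultimately show ?thesis using sub neg pos by blast
qed

end
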